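(* For every density operator $\rho$ on $L^2(\mathbb T,d\theta)$ and every real $a>0$, the quadratic standard variance $\Delta_{\rm std}(N)^2$ of the number observable and the quadratic chordal variance $\Delta_{\rm cho}(\Theta)^2$ of the angle observable in the state $\rho$ satisfy $$\Delta_{\rm std}(N)^2+\frac{a\,(8a^2+5a+2)}{8a+4}\ \Delta_{\rm cho}(\Theta)^2\ \ge\ a .$$
   Context: $\mathbb T$ is the circle (angles mod $2\pi$), and $e_n(\theta)=e^{-in\theta}/\sqrt{2\pi}$, $n\in\mathbb Z$. For a density operator $\rho$ on $L^2(\mathbb T,d\theta)$ let $\rho_N(n)=\langle e_n|\rho|e_n\rangle$ be the distribution of the number observable, and let $\rho_\Theta$ be the probability density on $\mathbb T$ of the angle observable, i.e. $\int d\theta\,\rho_\Theta(\theta)f(\theta)=\operatorname{tr}(\rho M_f)$ with $M_f$ multiplication by $f$. Define $$\Delta_{\rm std}(N)^2=\min_{m\in\mathbb Z}\sum_{n\in\mathbb Z}\rho_N(n)\,|n-m|^2\in[0,\infty],$$ $$\Delta_{\rm cho}(\Theta)^2=\min_{\theta'\in\mathbb T}\int d\theta\,\rho_\Theta(\theta)\,\bigl|e^{i\theta}-e^{i\theta'}\bigr|^2=2\Bigl(1-\Bigl|\int d\theta\,\rho_\Theta(\theta)e^{i\theta}\Bigr|\Bigr).$$ *)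

theory Defs
  imports "HOL-Analysis.Analysis"
begin

text \<open>
  Functions on the circle are represented by their restrictions to the fundamental domain
  $[0, 2\pi)$.  The library has no $L^2$ space as a type, so elements of $L^2(T, d\theta)$ are
  handled through representatives, and an operator on $L^2$ is a map on representatives that
  respects equality almost everywhere.
\<close>

definition circle :: "real measure" where
  "circle = restrict_space lborel {0..<2 * pi}"

definition L2 :: "(real \<Rightarrow> complex) set" where
  "L2 = {f \<in> borel_measurable circle. integrable circle (\<lambda>\<theta>. (cmod (f \<theta>))\<^sup>2)}"

definition L2_inner :: "(real \<Rightarrow> complex) \<Rightarrow> (real \<Rightarrow> complex) \<Rightarrow> complex" where
  "L2_inner f g = (LINT \<theta>|circle. cnj (f \<theta>) * g \<theta>)"

definition L2_norm :: "(real \<Rightarrow> complex) \<Rightarrow> real" where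
  "L2_norm f = sqrt (LINT \<theta>|circle. (cmod (f \<theta>))\<^sup>2)"

definition bounded_operator :: "((real \<Rightarrow> complex) \<Rightarrow> (real \<Rightarrow> complex)) \<Rightarrow> bool" where
  "bounded_operator T \<longleftrightarrow>
     (\<forall>f\<in>L2. T f \<in> L2) \<and>
     (\<forall>f\<in>L2. \<forall>g\<in>L2. (AE \<theta> in circle. f \<theta> = g \<theta>) \<longrightarrow> (AE \<theta> in circle. T f \<theta> = T g \<theta>)) \<and>
     (\<forall>f\<in>L2. \<forall>g\<in>L2. AE \<theta> in circle. T (\<lambda>x. f x + g x) \<theta> = T f \<theta> + T g \<theta>) \<and>
     (\<forall>c. \<forall>f\<in>L2. AE \<theta> in circle. T (\<lambda>x. c * f x) \<theta> = c * T f \<theta>) \<and>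
     (\<exists>C. \<forall>f\<in>L2. L2_norm (T f) \<le> C * L2_norm f)"

definition positive_operator :: "((real \<Rightarrow> complex) \<Rightarrow> (real \<Rightarrow> complex)) \<Rightarrow> bool" where
  "positive_operator T \<longleftrightarrow>
     bounded_operator T \<and> (\<forall>f\<in>L2. L2_inner f (T f) \<in> \<real>\<^sub>\<ge>\<^sub>0)"

text \<open>The orthonormal basis $e_n(\theta) = e^{-in\theta} / \sqrt{2\pi}$.\<close>

definition e :: "int \<Rightarrow> real \<Rightarrow> complex" where
  "e n \<theta> = cis (- (of_int n * \<theta>)) / of_real (sqrt (2 * pi))"

text \<open>
  The trace of a trace class operator does not depend on the orthonormal basis used to compute it;
  a positive bounded operator is trace class iff the sum of its diagonal elements in one
  orthonormal basis converges.
\<close>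

definition op_trace :: "((real \<Rightarrow> complex) \<Rightarrow> (real \<Rightarrow> complex)) \<Rightarrow> complex" where
  "op_trace T = (\<Sum>\<^sub>\<infinity>n. L2_inner (e n) (T (e n)))"

definition density_operator :: "((real \<Rightarrow> complex) \<Rightarrow> (real \<Rightarrow> complex)) \<Rightarrow> bool" where
  "density_operator \<rho> \<longleftrightarrow>
     positive_operator \<rho> \<and>
     (\<lambda>n. L2_inner (e n) (\<rho> (e n))) summable_on UNIV \<and>
     op_trace \<rho> = 1"

definition mult_op :: "(real \<Rightarrow> complex) \<Rightarrow> (real \<Rightarrow> complex) \<Rightarrow> (real \<Rightarrow> complex)" where
  "mult_op f g = (\<lambda>\<theta>. f \<theta> * g \<theta>)"

text \<open>
  The diagonal elements of a positive operator are real and nonnegative, so taking the real part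
  only changes the type.
\<close>

definition number_distribution :: "((real \<Rightarrow> complex) \<Rightarrow> (real \<Rightarrow> complex)) \<Rightarrow> int \<Rightarrow> real" where
  "number_distribution \<rho> n = Re (L2_inner (e n) (\<rho> (e n)))"

text \<open>
  The angle density is determined only up to null sets: the predicate says that \<open>p\<close> is a version
  of it.
\<close>

definition angle_density :: "((real \<Rightarrow> complex) \<Rightarrow> (real \<Rightarrow> complex)) \<Rightarrow> (real \<Rightarrow> real) \<Rightarrow> bool" where
  "angle_density \<rho> p \<longleftrightarrow>
     integrable circle p \<and>
     (AE \<theta> in circle. 0 \<le> p \<theta>) \<and>
     (LINT \<theta>|circle. p \<theta>) = 1 \<and>
     (\<forall>f \<in> borel_measurable circle. bounded (f ` space circle) \<longrightarrow>
        (LINT \<theta>|circle. of_real (p \<theta>) * f \<theta>) = op_trace (\<rho> \<circ> mult_op f))"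

definition std_variance :: "(int \<Rightarrow> real) \<Rightarrow> ennreal" where
  "std_variance P = (INF m::int. \<Sum>\<^sub>\<infinity>n. ennreal (P n * \<bar>real_of_int (n - m)\<bar>\<^sup>2))"

definition chordal_variance :: "(real \<Rightarrow> real) \<Rightarrow> real" where
  "chordal_variance p =
     (INF \<theta>'\<in>{0..<2 * pi}. LINT \<theta>|circle. p \<theta> * (cmod (cis \<theta> - cis \<theta>'))\<^sup>2)"

end

(*
  Put u n = sqrt (P (n + m)) with P the number distribution. Positivity of the density operator
  bounds the first Fourier coefficient of the angle density by c1 = sum of u n * u (n + 1), so it
  suffices to show  sum of (n * u n)^2 + 2 K (1 - c1) >= a,  where K is the constant in the theorem.
  This says that the Mathieu operator  H = - d^2/dx^2 + 2 K (1 - cos x)  satisfies H >= a.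
  With k = a^2 / (4 a + 2), D = 1 - cos x and w = sin x * (a + k * D) one has
     H - a = A* A + D^3 * k * (2 (a - k) + k * D)  for  A = d/dx + w,
  a sum of squares because 0 < k < a. The value of k is the one that makes the remainder vanish to
  third order in D. On Fourier coefficients every square is a finite difference expression.
*)

theory Submission
  imports Defs
begin

section \<open>Unordered sums over the integers\<close>

lemma has_sum_shift_int:
  fixes f :: "int \<Rightarrow> 'a::topological_comm_monoid_add"
  shows "((\<lambda>n. f (n + j)) has_sum s) UNIV \<longleftrightarrow> (f has_sum s) UNIV"
  by (rule has_sum_reindex_bij_betw, rule bij_betw_byWitness[where f' = "\<lambda>n. n - j"]) auto

text \<open>The product is dominated by the sum of the squares; this gives convergence of every
  correlation sum below.\<close>

lemma summable_on_mult_of_squares: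
  fixes f g :: "'i \<Rightarrow> real"
  assumes "(\<lambda>i. (f i)\<^sup>2) summable_on A" "(\<lambda>i. (g i)\<^sup>2) summable_on A"
  shows "(\<lambda>i. f i * g i) summable_on A"
proof (rule Infinite_Sum.abs_summable_summable, rule Infinite_Sum.abs_summable_on_comparison_test')
  show "(\<lambda>i. (f i)\<^sup>2 + (g i)\<^sup>2) summable_on A"
    using assms by (rule summable_on_add)
  show "norm (f i * g i) \<le> (f i)\<^sup>2 + (g i)\<^sup>2" for i
  proof -
    have "2 * \<bar>f i * g i\<bar> \<le> (f i)\<^sup>2 + (g i)\<^sup>2"
      using sum_squares_bound[of "\<bar>f i\<bar>" "\<bar>g i\<bar>"] by (simp add: abs_mult)
    then show ?thesis by simp
  qed
qed

section \<open>The Mathieu inequality on Fourier coefficients\<close>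

text \<open>For the unit vector with Fourier coefficients \<open>u\<close>, \<open>M\<close> is the
  mean of -d^2/dx^2 and \<open>c1\<close> the mean of cos x, so the left side is the quadratic form
  of H. Both sides of the operator identity are expressed through \<open>M\<close> and the
  correlations of \<open>u\<close>.\<close>

lemma discrete_mathieu_bound:
  fixes u :: "int \<Rightarrow> real" and a :: real
  assumes norm_u: "((\<lambda>n. (u n)\<^sup>2) has_sum 1) UNIV"
    and moment: "((\<lambda>n. (of_int n * u n)\<^sup>2) has_sum M) UNIV"
    and corr: "((\<lambda>n. u n * u (n + 1)) has_sum c1) UNIV"
    and "a > 0"
  shows "M + a * (8 * a\<^sup>2 + 5 * a + 2) / (8 * a + 4) * (2 * (1 - c1)) \<ge> a"
proof -
  define k where "k = a\<^sup>2 / (4 * a + 2)"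
  \<comment> \<open>This equation says that the coefficient of D^2 in w^2 - w' vanishes.\<close>
  have k: "a\<^sup>2 = 2 * k + 4 * a * k" and "k > 0"
    using \<open>a > 0\<close> by (auto simp: k_def divide_simps) (simp add: algebra_simps)
  have "k < a"
  proof -
    have "a\<^sup>2 < a * (4 * a + 2)" using \<open>a > 0\<close> by (simp add: power2_eq_square algebra_simps add_pos_pos)
    then show ?thesis using \<open>a > 0\<close> by (simp add: k_def pos_divide_less_eq)
  qed
  \<comment> \<open>The right side is the coefficient of D in w^2 - w'.\<close>
  have K: "a * (8 * a\<^sup>2 + 5 * a + 2) / (8 * a + 4) * 2 = 2 * a\<^sup>2 + a - 3 * k"
    using \<open>a > 0\<close> by (simp add: k_def divide_simps) (simp add: power2_eq_square algebra_simps)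
  have shifted_sq: "(\<lambda>n. (u (n + j))\<^sup>2) summable_on UNIV" for j
    using norm_u has_sum_shift_int[of "\<lambda>n. (u n)\<^sup>2" j 1] has_sum_imp_summable by blast
  define c where "c j = (\<Sum>\<^sub>\<infinity>n. u n * u (n + j))" for j
  have c: "((\<lambda>n. u n * u (n + j)) has_sum c j) UNIV" for j
    unfolding c_def
    using summable_on_mult_of_squares[OF shifted_sq[of 0] shifted_sq[of j]] has_sum_infsum by auto
  have cc: "((\<lambda>n. u (n + i) * u (n + j)) has_sum c (j - i)) UNIV" for i j
    using c[of "j - i"] has_sum_shift_int[of "\<lambda>n. u n * u (n + (j - i))" i]
    by (simp add: algebra_simps)
  have "c 0 = 1" 
    using has_sum_unique[OF c[of 0]] norm_u by (simp add: power2_eq_square)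
  have "c 1 = c1" using has_sum_unique[OF c corr] .
  define d where "d j = (\<Sum>\<^sub>\<infinity>n. (of_int n * u n) * u (n + j))" for j
  have d: "((\<lambda>n. (of_int n * u n) * u (n + j)) has_sum d j) UNIV" for j
    unfolding d_def
    using summable_on_mult_of_squares[OF has_sum_imp_summable[OF moment] shifted_sq[of j]] has_sum_infsum
    by blast
  \<comment> \<open>Shifting by \<open>j\<close> turns the factor n into n + j. The extra
    \<open>j * c j\<close> is the discrete trace of differentiating sin(jx).\<close>
  have d': "((\<lambda>n. (of_int n * u n) * u (n - j)) has_sum (d j + of_int j * c j)) UNIV" for j
  proof -
    have "((\<lambda>n. (of_int n * u n) * u (n + j) + of_int j * (u n * u (n + j))) has_sum (d j + of_int j * c j)) UNIV"
      by (intro has_sum_add has_sum_cmult_right d c)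
    then show ?thesis
      using has_sum_shift_int[of "\<lambda>n. (of_int n * u n) * u (n - j)" j "d j + of_int j * c j"]
      by (simp add: algebra_simps)
  qed
  \<comment> \<open>\<open>B\<close> is \<open>A\<close> up to a phase; \<open>D3\<close> and \<open>D4\<close> have squared norms \<open>8 \<langle>u, D\<^sup>3 u\<rangle>\<close> and \<open>16 \<langle>u, D\<^sup>4 u\<rangle>\<close>.\<close>
  define \<alpha> where "\<alpha> = (a + k) / 2"
  define \<beta> where "\<beta> = - k / 4"
  define B where "B n = of_int n * u n - \<alpha> * (u (n + -1) - u (n + 1)) - \<beta> * (u (n + -2) - u (n + 2))" for n
  define D3 where "D3 n = u (n + 3) - 3 * u (n + 2) + 3 * u (n + 1) - u n" for n
  define D4 where "D4 n = u (n + 4) - 4 * u (n + 3) + 6 * u (n + 2) - 4 * u (n + 1) + u n" for n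
  have csq: "((\<lambda>n. (u (n + i))\<^sup>2) has_sum 1) UNIV" for i
    using cc[of i i] \<open>c 0 = 1\<close> by (simp add: power2_eq_square)
  have D3: "((\<lambda>n. (D3 n)\<^sup>2) has_sum (20 - 30 * c 1 + 12 * c 2 - 2 * c 3)) UNIV"
  proof -
    \<comment> \<open>The shift by 0 and the form \<open>+ - 6 *\<close> let each summand match
      \<open>cc\<close> or \<open>csq\<close> under the sum and scaling rules. The resulting
      coefficients are those of (2 - 2 cos x)^3.\<close>
    have "((\<lambda>n. (u (n + 3))\<^sup>2 + 9 * (u (n + 2))\<^sup>2 + 9 * (u (n + 1))\<^sup>2 + (u (n+0))\<^sup>2
       + - 6 * (u (n+2) * u (n+3)) + 6 * (u (n+1) * u (n+3)) + - 2 * (u (n+0) * u (n+3))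
       + - 18 * (u (n+1) * u (n+2)) + 6 * (u (n+0) * u (n+2)) + - 6 * (u (n+0) * u (n+1))) has_sum
      (1 + 9 * 1 + 9 * 1 + 1 + - 6 * c (3-2) + 6 * c (3-1) + - 2 * c (3-0) + - 18 * c (2-1) + 6 * c (2-0) + - 6 * c (1-0))) UNIV"
      by (intro has_sum_add has_sum_cmult_right cc csq)
    then show ?thesis
      by (simp add: D3_def power2_eq_square algebra_simps)
  qed
  have D4: "((\<lambda>n. (D4 n)\<^sup>2) has_sum (70 - 112 * c 1 + 56 * c 2 - 16 * c 3 + 2 * c 4)) UNIV"
  proof -
    have "((\<lambda>n. (u (n + 4))\<^sup>2 + 16 * (u (n + 3))\<^sup>2 + 36 * (u (n + 2))\<^sup>2 + 16 * (u (n + 1))\<^sup>2 + (u (n+0))\<^sup>2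
       + - 8 * (u (n+3) * u (n+4)) + 12 * (u (n+2) * u (n+4)) + - 8 * (u (n+1) * u (n+4)) + 2 * (u (n+0) * u (n+4))
       + - 48 * (u (n+2) * u (n+3)) + 32 * (u (n+1) * u (n+3)) + - 8 * (u (n+0) * u (n+3))
       + - 48 * (u (n+1) * u (n+2)) + 12 * (u (n+0) * u (n+2)) + - 8 * (u (n+0) * u (n+1))) has_sum
      (1 + 16 * 1 + 36 * 1 + 16 * 1 + 1 + - 8 * c (4-3) + 12 * c (4-2) + - 8 * c (4-1) + 2 * c (4-0)
       + - 48 * c (3-2) + 32 * c (3-1) + - 8 * c (3-0) + - 48 * c (2-1) + 12 * c (2-0) + - 8 * c (1-0))) UNIV"
      by (intro has_sum_add has_sum_cmult_right cc csq)
    then show ?thesis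
      by (simp add: D4_def power2_eq_square algebra_simps)
  qed
  \<comment> \<open>Here w = (a + k) sin x - (k/2) sin 2x, and halving its coefficients gives
    \<alpha> and \<beta>. The unknown \<open>d 1\<close> and \<open>d 2\<close> cancel against
    \<open>d'\<close>; the linear terms left over are the mean of -w', the quadratic ones that of
    w^2.\<close>
  have B: "((\<lambda>n. (B n)\<^sup>2) has_sum (M - 2 * \<alpha> * c 1 - 4 * \<beta> * c 2
      + \<alpha>\<^sup>2 * (2 - 2 * c 2) + \<beta>\<^sup>2 * (2 - 2 * c 4) + 2 * \<alpha> * \<beta> * (2 * c 1 - 2 * c 3))) UNIV"
  proof -
    have "((\<lambda>n. (of_int n * u n)\<^sup>2 
        + (- 2 * \<alpha>) * ((of_int n * u n) * u (n - 1)) + 2 * \<alpha> * ((of_int n * u n) * u (n + 1))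
        + (- 2 * \<beta>) * ((of_int n * u n) * u (n - 2)) + 2 * \<beta> * ((of_int n * u n) * u (n + 2))
        + \<alpha>\<^sup>2 * ((u (n + -1))\<^sup>2 + (u (n + 1))\<^sup>2 + - 2 * (u (n + -1) * u (n + 1)))
        + \<beta>\<^sup>2 * ((u (n + -2))\<^sup>2 + (u (n + 2))\<^sup>2 + - 2 * (u (n + -2) * u (n + 2)))
        + 2 * \<alpha> * \<beta> * (u (n + -2) * u (n + -1) + u (n + 1) * u (n + 2)
             + - 1 * (u (n + -1) * u (n + 2)) + - 1 * (u (n + -2) * u (n + 1)))) has_sum
      (M + (- 2 * \<alpha>) * (d 1 + of_int 1 * c 1) + 2 * \<alpha> * d 1 
        + (- 2 * \<beta>) * (d 2 + of_int 2 * c 2) + 2 * \<beta> * d 2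
        + \<alpha>\<^sup>2 * (1 + 1 + - 2 * c (1 - - 1)) + \<beta>\<^sup>2 * (1 + 1 + - 2 * c (2 - - 2))
        + 2 * \<alpha> * \<beta> * (c (-1 - - 2) + c (2 - 1) + - 1 * c (2 - - 1) + - 1 * c (1 - - 2)))) UNIV"
      by (intro has_sum_add has_sum_cmult_right cc csq d d' moment)
    moreover have "(of_int n * u n)\<^sup>2 
        + (- 2 * \<alpha>) * ((of_int n * u n) * u (n - 1)) + 2 * \<alpha> * ((of_int n * u n) * u (n + 1))
        + (- 2 * \<beta>) * ((of_int n * u n) * u (n - 2)) + 2 * \<beta> * ((of_int n * u n) * u (n + 2))
        + \<alpha>\<^sup>2 * ((u (n + -1))\<^sup>2 + (u (n + 1))\<^sup>2 + - 2 * (u (n + -1) * u (n + 1)))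
        + \<beta>\<^sup>2 * ((u (n + -2))\<^sup>2 + (u (n + 2))\<^sup>2 + - 2 * (u (n + -2) * u (n + 2)))
        + 2 * \<alpha> * \<beta> * (u (n + -2) * u (n + -1) + u (n + 1) * u (n + 2)
             + - 1 * (u (n + -1) * u (n + 2)) + - 1 * (u (n + -2) * u (n + 1))) = (B n)\<^sup>2" for n
      unfolding B_def by (simp add: power2_eq_square algebra_simps)
    ultimately show ?thesis
      by (simp add: algebra_simps)
  qed
  \<comment> \<open>After the norm factors 8 and 16 the last two weights become 2k(a - k) for D^3
    and k^2 for D^4.\<close>
  have nonneg: "0 \<le> M - 2 * \<alpha> * c 1 - 4 * \<beta> * c 2
      + \<alpha>\<^sup>2 * (2 - 2 * c 2) + \<beta>\<^sup>2 * (2 - 2 * c 4) + 2 * \<alpha> * \<beta> * (2 * c 1 - 2 * c 3)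
      + k * (a - k) / 4 * (20 - 30 * c 1 + 12 * c 2 - 2 * c 3)
      + k\<^sup>2 / 16 * (70 - 112 * c 1 + 56 * c 2 - 16 * c 3 + 2 * c 4)"
    using \<open>k > 0\<close> \<open>k < a\<close>
    by (intro add_nonneg_nonneg mult_nonneg_nonneg has_sum_nonneg[OF B] has_sum_nonneg[OF D3] has_sum_nonneg[OF D4]) auto
  have "a * (8 * a\<^sup>2 + 5 * a + 2) / (8 * a + 4) * (2 * (1 - c1)) = (2 * a\<^sup>2 + a - 3 * k) * (1 - c 1)"
    using K \<open>c 1 = c1\<close> by (metis mult.assoc)
  moreover have "M + (2 * a\<^sup>2 + a - 3 * k) * (1 - c 1) - a = M - 2 * \<alpha> * c 1 - 4 * \<beta> * c 2
      + \<alpha>\<^sup>2 * (2 - 2 * c 2) + \<beta>\<^sup>2 * (2 - 2 * c 4) + 2 * \<alpha> * \<beta> * (2 * c 1 - 2 * c 3)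
      + k * (a - k) / 4 * (20 - 30 * c 1 + 12 * c 2 - 2 * c 3)
      + k\<^sup>2 / 16 * (70 - 112 * c 1 + 56 * c 2 - 16 * c 3 + 2 * c 4)"
    (is "?l = ?r")
  proof -
    \<comment> \<open>The first factor is the mean of D^2; the second is zero by the choice of
      \<open>k\<close>.\<close>
    have "?l - ?r = (3 / 2 - 2 * c 1 + c 2 / 2) * (a\<^sup>2 - (2 * k + 4 * a * k))"
      unfolding \<alpha>_def \<beta>_def by (simp add: power2_eq_square field_simps)
    then show ?thesis using k by simp
  qed
  ultimately show ?thesis using nonneg by linarith
qed

section \<open>Positive sesquilinear forms in two variables\<close>

text \<open>Hermitian symmetry is not assumed: it follows from the form being real. Rotating away
  the phase of \<open>b\<close> then leaves a real quadratic form.\<close>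

lemma cauchy_schwarz_of_positive_form:
  fixes P Q :: real and b b' :: complex
  assumes pos: "\<And>x y :: complex. cnj x * x * of_real P + cnj x * y * b + cnj y * x * b' + cnj y * y * of_real Q \<in> \<real>\<^sub>\<ge>\<^sub>0"
  shows "cmod b \<le> sqrt P * sqrt Q"
proof -
  have PQ: "P \<ge> 0" "Q \<ge> 0"
    using pos[of 1 0] pos[of 0 1] by auto
  \<comment> \<open>Reality at (1, 1) makes the imaginary parts opposite; at (1, \<i>) it makes the
    real parts equal.\<close>
  have "b' = cnj b"
    using pos[of 1 1] pos[of 1 \<i>] by (auto simp: complex_nonneg_Reals_iff complex_eq_iff)
  have form: "2 * s * t * cmod b \<le> s\<^sup>2 * P + t\<^sup>2 * Q" for s t :: real
  proof -
    \<comment> \<open>The phase of \<open>b\<close>; since \<open>sgn 0 = 0\<close>, the case b = 0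
      needs a separate unimodular value.\<close>
    define w where "w = (if b = 0 then 1 else sgn b)"
    have w: "cnj w * w = 1"
      by (simp add: w_def mult.commute[of "cnj _"] complex_norm_square[symmetric] norm_sgn)
    have b: "b = of_real (cmod b) * w"
      by (simp add: w_def sgn_eq)
    have "cnj b = of_real (cmod b) * cnj w"
      by (subst b) simp
    with \<open>b' = cnj b\<close> have b': "b' = of_real (cmod b) * cnj w" by simp
    \<comment> \<open>Naming the modulus removes \<open>b\<close> from the right side of its own
      polar form, so that unfolding terminates.\<close>
    define r where "r = cmod b"
    note r = r_def b[folded r_def] b'[folded r_def]
    define x y where "x = complex_of_real s" and "y = - complex_of_real t * cnj w"
    have "cnj x * x * of_real P + cnj x * y * b + cnj y * x * b' + cnj y * y * of_real Q
      = of_real (s\<^sup>2 * P) - 2 * of_real (s * t * r) * (cnj w * w) + of_real (t\<^sup>2 * Q) * (cnj w * w)"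
      unfolding x_def y_def r(2,3) by (simp add: power2_eq_square algebra_simps)
    also have "\<dots> = of_real (s\<^sup>2 * P - 2 * (s * t * r) + t\<^sup>2 * Q)"
      by (simp add: w)
    finally have "0 \<le> s\<^sup>2 * P - 2 * (s * t * r) + t\<^sup>2 * Q"
      using pos[of x y] by (simp only: nonneg_Reals_of_real_iff)
    then show ?thesis by (simp add: r_def)
  qed
  show ?thesis
  proof (cases "P = 0 \<or> Q = 0")
    case True
    have "b = 0"
    proof (rule ccontr)
      assume "b \<noteq> 0"
      \<comment> \<open>With one diagonal entry zero, \<open>form\<close> bounds a linear function
        of s by a constant; this s exceeds the bound.\<close>
      define s where "s = (P + Q) / cmod b + 1"
      have s: "s * cmod b = P + Q + cmod b" and "cmod b > 0"
        using \<open>b \<noteq> 0\<close> by (simp_all add: s_def field_simps)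
      have "2 * (s * cmod b) \<le> P + Q"
        using True form[of s 1] form[of 1 s] by (auto simp: mult.assoc)
      then show False using s \<open>cmod b > 0\<close> PQ by linarith
    qed
    then show ?thesis using PQ by simp
  next
    case False
    then have "P > 0" "Q > 0" using PQ by auto
    \<comment> \<open>At s = sqrt Q, t = sqrt P both diagonal terms equal P Q.\<close>
    have "sqrt P * sqrt Q * cmod b \<le> sqrt P * sqrt Q * (sqrt P * sqrt Q)"
      using form[of "sqrt Q" "sqrt P"] PQ by (simp add: algebra_simps)
    then show ?thesis using \<open>P > 0\<close> \<open>Q > 0\<close> by simp
  qed
qed

section \<open>Square-integrable functions on the circle\<close>

lemma measurable_circle:
  "f \<in> borel_measurable borel \<Longrightarrow> f \<in> borel_measurable circle"
  by (simp add: circle_def measurable_restrict_space1)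

lemma finite_measure_circle: "finite_measure circle"
  by (rule finite_measureI) (simp add: circle_def emeasure_restrict_space space_restrict_space)

lemma L2_measurable: "f \<in> L2 \<Longrightarrow> f \<in> borel_measurable circle"
  by (simp add: L2_def)

lemma e_in_L2: "e n \<in> L2"
proof -
  interpret finite_measure circle by (rule finite_measure_circle)
  have "e n \<in> borel_measurable borel"
    unfolding e_def by (intro borel_measurable_continuous_onI continuous_intros) auto
  moreover have "integrable circle (\<lambda>\<theta>. (cmod (e n \<theta>))\<^sup>2)"
    by (simp add: e_def norm_divide)
  ultimately show ?thesis by (simp add: L2_def measurable_circle)
qed

lemma L2_cmult:
  assumes "f \<in> L2"
  shows "(\<lambda>\<theta>. c * f \<theta>) \<in> L2"
  using assms by (auto simp: L2_def norm_mult power_mult_distrib)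

lemma L2_add:
  assumes "f \<in> L2" "g \<in> L2"
  shows "(\<lambda>\<theta>. f \<theta> + g \<theta>) \<in> L2"
proof -
  note [measurable] = assms[THEN L2_measurable]
  have "integrable circle (\<lambda>\<theta>. (cmod (f \<theta> + g \<theta>))\<^sup>2)"
  proof (rule Bochner_Integration.integrable_bound)
    show "integrable circle (\<lambda>\<theta>. 2 * (cmod (f \<theta>))\<^sup>2 + 2 * (cmod (g \<theta>))\<^sup>2)"
      using assms by (auto simp: L2_def)
    have "(cmod (x + y))\<^sup>2 \<le> 2 * (cmod x)\<^sup>2 + 2 * (cmod y)\<^sup>2" for x y
    proof -
      have "(cmod (x + y))\<^sup>2 \<le> (cmod x + cmod y)\<^sup>2"
        by (simp add: norm_triangle_ineq power_mono)
      then show ?thesis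
        using sum_squares_bound[of "cmod x" "cmod y"] by (simp add: power2_sum)
    qed
    then show "AE \<theta> in circle. norm ((cmod (f \<theta> + g \<theta>))\<^sup>2) \<le> norm (2 * (cmod (f \<theta>))\<^sup>2 + 2 * (cmod (g \<theta>))\<^sup>2)"
      by auto
  qed measurable
  then show ?thesis by (simp add: L2_def)
qed

lemma integrable_L2_inner:
  assumes "f \<in> L2" "g \<in> L2"
  shows "integrable circle (\<lambda>\<theta>. cnj (f \<theta>) * g \<theta>)"
proof (rule Bochner_Integration.integrable_bound)
  note [measurable] = assms[THEN L2_measurable]
  show "integrable circle (\<lambda>\<theta>. (cmod (f \<theta>))\<^sup>2 + (cmod (g \<theta>))\<^sup>2)"
    using assms by (auto simp: L2_def)
  have [measurable]: "cnj \<in> borel_measurable borel"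
    by (intro borel_measurable_continuous_onI continuous_intros)
  show "(\<lambda>\<theta>. cnj (f \<theta>) * g \<theta>) \<in> borel_measurable circle" by measurable
  have "cmod x * cmod y \<le> (cmod x)\<^sup>2 + (cmod y)\<^sup>2" for x y
  proof -
    have "0 \<le> cmod x * cmod y" by simp
    moreover have "2 * (cmod x * cmod y) \<le> (cmod x)\<^sup>2 + (cmod y)\<^sup>2"
      using sum_squares_bound[of "cmod x" "cmod y"] by (simp only: mult.assoc)
    ultimately show ?thesis by linarith
  qed
  then show "AE \<theta> in circle. norm (cnj (f \<theta>) * g \<theta>) \<le> norm ((cmod (f \<theta>))\<^sup>2 + (cmod (g \<theta>))\<^sup>2)"
    by (simp add: norm_mult)
qed

lemma L2_inner_lincomb_left:
  assumes "f \<in> L2" "g \<in> L2" "h \<in> L2"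
  shows "L2_inner (\<lambda>\<theta>. x * f \<theta> + y * g \<theta>) h = cnj x * L2_inner f h + cnj y * L2_inner g h"
  using integrable_L2_inner[OF assms(1,3)] integrable_L2_inner[OF assms(2,3)]
  by (simp add: L2_inner_def distrib_right mult.assoc)

lemma L2_inner_lincomb_right:
  assumes "f \<in> L2" "g \<in> L2" "h \<in> L2"
  shows "L2_inner h (\<lambda>\<theta>. x * f \<theta> + y * g \<theta>) = x * L2_inner h f + y * L2_inner h g"
  using integrable_L2_inner[OF assms(3,1)] integrable_L2_inner[OF assms(3,2)]
  by (simp add: L2_inner_def distrib_left mult.left_commute)

lemma L2_inner_cong_AE:
  assumes "f \<in> L2" "g \<in> L2" "h \<in> L2" "AE \<theta> in circle. f \<theta> = g \<theta>"
  shows "L2_inner h f = L2_inner h g"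
  unfolding L2_inner_def
proof (rule integral_cong_AE)
  show "AE \<theta> in circle. cnj (h \<theta>) * f \<theta> = cnj (h \<theta>) * g \<theta>"
    using assms(4) by auto
qed (intro borel_measurable_integrable integrable_L2_inner assms)+

section \<open>Bounded and positive operators\<close>

lemma bounded_operator_in_L2: "bounded_operator T \<Longrightarrow> f \<in> L2 \<Longrightarrow> T f \<in> L2"
  by (simp add: bounded_operator_def)

lemma bounded_operator_lincomb:
  assumes "bounded_operator T" "f \<in> L2" "g \<in> L2"
  shows "AE \<theta> in circle. T (\<lambda>\<theta>. x * f \<theta> + y * g \<theta>) \<theta> = x * T f \<theta> + y * T g \<theta>"
proof -
  have add: "AE \<theta> in circle. T (\<lambda>\<theta>. f \<theta> + g \<theta>) \<theta> = T f \<theta> + T g \<theta>"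
      if "f \<in> L2" "g \<in> L2" for f g
    using assms(1) that by (simp add: bounded_operator_def)
  have cmult: "AE \<theta> in circle. T (\<lambda>\<theta>. c * f \<theta>) \<theta> = c * T f \<theta>" if "f \<in> L2" for c f
    using assms(1) that by (simp add: bounded_operator_def)
  from add[OF L2_cmult[OF assms(2), of x] L2_cmult[OF assms(3), of y]]
    cmult[OF assms(2), of x] cmult[OF assms(3), of y]
  show ?thesis by eventually_elim simp
qed

text \<open>Positivity on the span of \<open>f\<close> and \<open>g\<close> is a form in the two
  coefficients, with \<open>L2_inner f (T g)\<close> off the diagonal.\<close>

lemma positive_operator_cauchy_schwarz:
  assumes "positive_operator T" "f \<in> L2" "g \<in> L2"
  shows "cmod (L2_inner f (T g)) \<le> sqrt (Re (L2_inner f (T f))) * sqrt (Re (L2_inner g (T g)))"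
proof (rule cauchy_schwarz_of_positive_form)
  have T: "bounded_operator T" and pos: "\<And>h. h \<in> L2 \<Longrightarrow> L2_inner h (T h) \<in> \<real>\<^sub>\<ge>\<^sub>0"
    using assms(1) by (auto simp: positive_operator_def)
  fix x y :: complex
  let ?h = "\<lambda>\<theta>. x * f \<theta> + y * g \<theta>"
  have h: "?h \<in> L2" using assms by (intro L2_add L2_cmult)
  have TL2: "T f \<in> L2" "T g \<in> L2" "T ?h \<in> L2"
    using bounded_operator_in_L2[OF T] assms h by blast+
  have diag: "of_real (Re (L2_inner h (T h))) = L2_inner h (T h)" if "h \<in> L2" for h
    using pos[OF that] by (simp add: complex_nonneg_Reals_iff complex_eq_iff)
  \<comment> \<open>Linearity of \<open>T\<close> holds only almost everywhere, so it is applied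
    inside the inner product.\<close>
  have "L2_inner ?h (T ?h) = L2_inner ?h (\<lambda>\<theta>. x * T f \<theta> + y * T g \<theta>)"
    using TL2 h by (intro L2_inner_cong_AE bounded_operator_lincomb T assms L2_add L2_cmult)
  also have "\<dots> = x * (cnj x * L2_inner f (T f) + cnj y * L2_inner g (T f))
      + y * (cnj x * L2_inner f (T g) + cnj y * L2_inner g (T g))"
    using TL2 h assms by (simp add: L2_inner_lincomb_right L2_inner_lincomb_left)
  also have "\<dots> = cnj x * x * of_real (Re (L2_inner f (T f))) + cnj x * y * L2_inner f (T g)
      + cnj y * x * L2_inner g (T f) + cnj y * y * of_real (Re (L2_inner g (T g)))"
    using assms by (simp add: diag algebra_simps)
  finally show "cnj x * x * of_real (Re (L2_inner f (T f))) + cnj x * y * L2_inner f (T g)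
      + cnj y * x * L2_inner g (T f) + cnj y * y * of_real (Re (L2_inner g (T g))) \<in> \<real>\<^sub>\<ge>\<^sub>0"
    using pos[OF h] by simp
qed

section \<open>Number and angle statistics of a density operator\<close>

lemma number_distribution_nonneg: "density_operator \<rho> \<Longrightarrow> 0 \<le> number_distribution \<rho> n"
  using e_in_L2[of n]
  by (auto simp: density_operator_def positive_operator_def number_distribution_def complex_nonneg_Reals_iff)

lemma number_distribution_has_sum:
  assumes "density_operator \<rho>"
  shows "(number_distribution \<rho> has_sum 1) UNIV"
proof -
  have "((\<lambda>n. L2_inner (e n) (\<rho> (e n))) has_sum 1) UNIV"
    using assms has_sum_infsum by (fastforce simp: density_operator_def op_trace_def)
  from has_sum_Re[OF this] show ?thesis
    by (simp add: number_distribution_def[abs_def])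
qed

text \<open>The negative exponent in \<open>e\<close> makes \<open>cis\<close> lower the
  index.\<close>

lemma mult_op_cis_e: "mult_op cis (e n) = e (n - 1)"
  by (rule ext) (simp add: mult_op_def e_def cis_mult algebra_simps)

text \<open>The trace against \<open>cis\<close> sums one off-diagonal of \<rho>, and each entry is
  at most the geometric mean of the two diagonal entries beside it.\<close>

lemma angle_density_cis_bound:
  assumes \<rho>: "density_operator \<rho>" and p: "angle_density \<rho> p"
    and c: "((\<lambda>n. sqrt (number_distribution \<rho> n) * sqrt (number_distribution \<rho> (n + 1))) has_sum c) UNIV"
  shows "cmod (LINT \<theta>|circle. of_real (p \<theta>) * cis \<theta>) \<le> c"
proof -
  have pos: "positive_operator \<rho>" using \<rho> by (simp add: density_operator_def)
  let ?P = "number_distribution \<rho>"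
  have c': "((\<lambda>n. sqrt (?P n) * sqrt (?P (n - 1))) has_sum c) UNIV"
    using has_sum_shift_int[of "\<lambda>n. sqrt (?P n) * sqrt (?P (n - 1))" 1 c] c
    by (simp add: mult.commute)
  have bound: "cmod (L2_inner (e n) (\<rho> (e (n - 1)))) \<le> sqrt (?P n) * sqrt (?P (n - 1))" for n
    unfolding number_distribution_def by (rule positive_operator_cauchy_schwarz[OF pos e_in_L2 e_in_L2])
  have abs: "(\<lambda>n. cmod (L2_inner (e n) (\<rho> (e (n - 1))))) summable_on UNIV"
    using has_sum_imp_summable[OF c'] bound by (rule Infinite_Sum.abs_summable_on_comparison_test')
  have "cis \<in> borel_measurable circle"
    by (intro measurable_circle borel_measurable_continuous_onI continuous_intros)
  moreover have "bounded (cis ` space circle)"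
    by (intro boundedI[where B = 1]) auto
  ultimately have "(LINT \<theta>|circle. of_real (p \<theta>) * cis \<theta>) = op_trace (\<rho> \<circ> mult_op cis)"
    using p by (simp add: angle_density_def)
  also have "cmod \<dots> \<le> (\<Sum>\<^sub>\<infinity>n. cmod (L2_inner (e n) (\<rho> (e (n - 1)))))"
    using norm_infsum_bound[OF abs] by (simp add: op_trace_def mult_op_cis_e)
  also have "\<dots> \<le> c"
    using bound by (intro has_sum_mono[OF has_sum_infsum[OF abs] c'])
  finally show ?thesis .
qed

text \<open>The squared chord is 2 - 2 cos(\<theta> - t), so each integral is 2 minus twice the real
  part of the first moment rotated by -t, and that real part is at most the modulus.\<close>

lemma chordal_variance_lower_bound:
  assumes "integrable circle p" "(LINT \<theta>|circle. p \<theta>) = 1"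
  shows "2 * (1 - cmod (LINT \<theta>|circle. of_real (p \<theta>) * cis \<theta>)) \<le> chordal_variance p"
  unfolding chordal_variance_def
proof (rule cINF_greatest)
  show "{0..<2 * pi} \<noteq> {}" by simp
  fix t :: real
  let ?z = "LINT \<theta>|circle. of_real (p \<theta>) * cis \<theta>"
  have [measurable]: "p \<in> borel_measurable circle" "cis \<in> borel_measurable circle"
    using assms(1) by (auto intro!: measurable_circle borel_measurable_continuous_onI continuous_intros)
  have int: "integrable circle (\<lambda>\<theta>. of_real (p \<theta>) * cis \<theta>)"
    by (rule Bochner_Integration.integrable_bound[OF assms(1)]) (auto simp: norm_mult)
  have eq: "p \<theta> * (cmod (cis \<theta> - cis t))\<^sup>2 = 2 * p \<theta> - 2 * Re (of_real (p \<theta>) * cis \<theta> * cis (- t))" for \<theta>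
  proof -
    have "(cmod (cis \<theta> - cis t))\<^sup>2 = ((cos \<theta>)\<^sup>2 + (sin \<theta>)\<^sup>2) + ((cos t)\<^sup>2 + (sin t)\<^sup>2) - 2 * (cos \<theta> * cos t + sin \<theta> * sin t)"
      unfolding cmod_power2 by (simp add: power2_eq_square algebra_simps)
    also have "\<dots> = 2 - 2 * (cos \<theta> * cos t + sin \<theta> * sin t)" by simp
    finally have "(cmod (cis \<theta> - cis t))\<^sup>2 = 2 - 2 * (cos \<theta> * cos t + sin \<theta> * sin t)" .
    then show ?thesis by (simp only:) (simp add: algebra_simps)
  qed
  have "(LINT \<theta>|circle. p \<theta> * (cmod (cis \<theta> - cis t))\<^sup>2) = 2 - 2 * Re (?z * cis (- t))"
    using assms int unfolding eq by (subst Bochner_Integration.integral_diff) (auto simp del: cis.sel times_complex.sel)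
  moreover have "Re (?z * cis (- t)) \<le> cmod ?z"
    using complex_Re_le_cmod[of "?z * cis (- t)"] by (simp add: norm_mult del: times_complex.sel)
  ultimately show "2 * (1 - cmod ?z) \<le> (LINT \<theta>|circle. p \<theta> * (cmod (cis \<theta> - cis t))\<^sup>2)"
    by simp
qed

section \<open>From extended sums to the uncertainty bound\<close>

text \<open>A finite extended value bounds all finite partial sums, which gives real
  summability.\<close>

lemma has_sum_of_infsum_ennreal_less_top:
  fixes f :: "'i \<Rightarrow> real"
  assumes "\<And>i. i \<in> A \<Longrightarrow> 0 \<le> f i" and fin: "(\<Sum>\<^sub>\<infinity>i\<in>A. ennreal (f i)) < top"
  obtains s where "(f has_sum s) A" "(\<Sum>\<^sub>\<infinity>i\<in>A. ennreal (f i)) = ennreal s"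
proof -
  have sup: "(\<Sum>\<^sub>\<infinity>i\<in>A. ennreal (f i)) = (SUP F\<in>{F. finite F \<and> F \<subseteq> A}. ennreal (sum f F))"
    using assms(1) by (subst nonneg_infsum_complete) (auto intro!: SUP_cong sum_ennreal)
  obtain C where "C \<ge> 0" and C: "(\<Sum>\<^sub>\<infinity>i\<in>A. ennreal (f i)) = ennreal C"
    using fin by (cases "\<Sum>\<^sub>\<infinity>i\<in>A. ennreal (f i)") auto
  have "sum f F \<le> C" if "finite F" "F \<subseteq> A" for F
  proof -
    have "ennreal (sum f F) \<le> ennreal C"
      using that unfolding C[symmetric] sup by (intro SUP_upper) auto
    then show ?thesis using \<open>C \<ge> 0\<close> by simp
  qed
  then have "f summable_on A"
    by (intro nonneg_bounded_partial_sums_imp_summable_on[where C = C] eventually_finite_subsets_at_top_weakI assms) auto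
  then show ?thesis
    using infsum_nonneg_is_SUPREMUM_ennreal[of f A] assms(1) sup that has_sum_infsum by metis
qed

theorem mainTheorem6:
  fixes \<rho> :: "(real \<Rightarrow> complex) \<Rightarrow> (real \<Rightarrow> complex)"
    and p :: "real \<Rightarrow> real"
    and a :: real
  assumes "density_operator \<rho>"
    and "angle_density \<rho> p"
    and "a > 0"
  shows "std_variance (number_distribution \<rho>)
           + ennreal (a * (8 * a\<^sup>2 + 5 * a + 2) / (8 * a + 4) * chordal_variance p)
         \<ge> ennreal a"
proof -
  let ?P = "number_distribution \<rho>"
  let ?K = "a * (8 * a\<^sup>2 + 5 * a + 2) / (8 * a + 4)"
  note P_nonneg = number_distribution_nonneg[OF assms(1)]
  have P_sq: "(sqrt (?P n))\<^sup>2 = ?P n" for n by (simp add: P_nonneg)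
  have P1: "(?P has_sum 1) UNIV" by (rule number_distribution_has_sum[OF assms(1)])
  have P1': "((\<lambda>n. ?P (n + j)) has_sum 1) UNIV" for j
    using P1 by (simp add: has_sum_shift_int)
  have K: "?K \<ge> 0" using \<open>a > 0\<close> by simp
  obtain c where c: "((\<lambda>n. sqrt (?P n) * sqrt (?P (n + 1))) has_sum c) UNIV"
  proof -
    have "(\<lambda>n. sqrt (?P n) * sqrt (?P (n + 1))) summable_on UNIV"
      by (rule summable_on_mult_of_squares; unfold P_sq; rule has_sum_imp_summable[OF P1] has_sum_imp_summable[OF P1'])
    then show ?thesis using that has_sum_infsum by blast
  qed
  have chord: "2 * (1 - c) \<le> chordal_variance p"
    using chordal_variance_lower_bound[of p] angle_density_cis_bound[OF assms(1,2) c] assms(2)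
    by (simp add: angle_density_def)
  have bound: "ennreal a \<le> (\<Sum>\<^sub>\<infinity>n. ennreal (?P n * \<bar>real_of_int (n - m)\<bar>\<^sup>2)) + ennreal (?K * chordal_variance p)" for m
  proof (cases "(\<Sum>\<^sub>\<infinity>n. ennreal (?P n * \<bar>real_of_int (n - m)\<bar>\<^sup>2)) < top")
    case True
    then obtain M where M: "((\<lambda>n. ?P n * \<bar>real_of_int (n - m)\<bar>\<^sup>2) has_sum M) UNIV"
      and M_eq: "(\<Sum>\<^sub>\<infinity>n. ennreal (?P n * \<bar>real_of_int (n - m)\<bar>\<^sup>2)) = ennreal M"
      using has_sum_of_infsum_ennreal_less_top[of UNIV "\<lambda>n. ?P n * \<bar>real_of_int (n - m)\<bar>\<^sup>2"] P_nonneg by auto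
    have "M \<ge> 0" using M by (rule has_sum_nonneg) (simp add: P_nonneg)
    \<comment> \<open>Recentring at m turns the deviation n - m into the index itself.\<close>
    define u where "u n = sqrt (?P (n + m))" for n
    have "a \<le> M + ?K * (2 * (1 - c))"
    proof (rule discrete_mathieu_bound)
      show "((\<lambda>n. (u n)\<^sup>2) has_sum 1) UNIV"
        by (simp add: u_def P_nonneg P1')
      show "((\<lambda>n. (of_int n * u n)\<^sup>2) has_sum M) UNIV"
        using has_sum_shift_int[of "\<lambda>n. ?P n * \<bar>real_of_int (n - m)\<bar>\<^sup>2" m M] M
        by (simp add: u_def power_mult_distrib P_nonneg mult.commute)
      show "((\<lambda>n. u n * u (n + 1)) has_sum c) UNIV"
        using has_sum_shift_int[of "\<lambda>n. sqrt (?P n) * sqrt (?P (n + 1))" m c] c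
        by (simp add: u_def add_ac)
    qed fact
    also have "\<dots> \<le> M + ?K * chordal_variance p"
      using K chord by (intro add_left_mono mult_left_mono)
    finally have "ennreal a \<le> ennreal (M + ?K * chordal_variance p)" by (rule ennreal_leI)
    \<comment> \<open>This holds for either sign of the chordal term, as \<open>ennreal\<close>
      sends negative numbers to 0.\<close>
    also have "\<dots> \<le> ennreal M + ennreal (?K * chordal_variance p)"
      by (simp add: \<open>M \<ge> 0\<close> ennreal_plus_if add_decreasing2 ennreal_leI)
    finally show ?thesis unfolding M_eq .
  next
    case False
    then have "(\<Sum>\<^sub>\<infinity>n. ennreal (?P n * \<bar>real_of_int (n - m)\<bar>\<^sup>2)) = top"
      using less_top by blast
    then show ?thesis by (simp only: top_add zero_le top_greatest)
  qed
  \<comment> \<open>Truncated subtraction isolates the infimum, so the bound for each m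
    suffices.\<close>
  have "ennreal a - ennreal (?K * chordal_variance p) \<le> std_variance ?P"
    unfolding std_variance_def
  proof (rule INF_greatest)
    fix m :: int
    show "ennreal a - ennreal (?K * chordal_variance p)
      \<le> (\<Sum>\<^sub>\<infinity>n. ennreal (?P n * \<bar>real_of_int (n - m)\<bar>\<^sup>2))"
      unfolding ennreal_minus_le_iff
      using bound[of m, unfolded add.commute[of _ "ennreal (?K * chordal_variance p)"]]
      by (intro conjI) (assumption, simp only: ennreal_neq_top simp_thms)
  qed
  then have "ennreal a \<le> ennreal (?K * chordal_variance p) + std_variance ?P"
    unfolding ennreal_minus_le_iff by (rule conjunct1)
  then show ?thesis
    unfolding add.commute[of _ "ennreal (?K * chordal_variance p)"] .
qed

end
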